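(* Let $\mathcal{H}$ be a separable Hilbert space, let $g\in\mathcal{H}$, and let $A$ and $B$ be bounded linear operators on $\mathcal{H}$. Suppose that: (i) any $f\in\mathcal{H}$ is recovered from the samples $\{\langle A^n f,g\rangle\}_{n\ge 0}$ in a stable way, and there exist real numbers $\lambda,\mu,\nu\ge 0$ such that for all $l\in\mathbb{Z}^+$ and all scalars $a_0,\dots,a_l$, $$\Big\|\sum_{n=0}^{l}a_n\big((A^* )^n-(B^* )^n\big)g\Big\|^2\le \lambda\Big\|\sum_{n=0}^{l}a_n(A^* )^n g\Big\|^2+\mu\Big\|\sum_{n=0}^{l}a_n(A^* )^n g\Big\|\,\Big\|\sum_{n=0}^{l}a_n(B^* )^n g\Big\|+\nu\Big\|\sum_{n=0}^{l}a_n(B^* )^n g\Big\|^2;$$ (ii) for some real $\epsilon>0$, these same $\lambda,\mu,\nu$ satisfy both $$2(1-\nu)\epsilon^2-(\mu+2\nu)\epsilon-\mu>0\quad\text{and}\quad \max\Big\{\lambda+\frac{\mu\epsilon}{2},\ \frac{\mu}{2\epsilon}+\nu\Big\}<1.$$ Then any $f\in\mathcal{H}$ can also be recovered from the samples $\{\langle B^n f,g\rangle\}_{n\ge 0}$ in a stable way.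
   Context: $\mathbb{Z}^+=\{0,1,2,\dots\}$, and $A^*,B^*$ denote the Hilbert-space adjoints of $A,B$. For a bounded linear operator $C$ on $\mathcal{H}$ and a vector $u\in\mathcal{H}$, "any $f\in\mathcal{H}$ is (can be) recovered from the samples $\{\langle C^n f,u\rangle\}_{n\ge 0}$ in a stable way" means: for every $f\in\mathcal{H}$ the sequence $\{\langle C^n f,u\rangle\}_{n\ge0}$ belongs to $\ell^2(\mathbb{Z}^+)$, and there exists a bounded linear operator $\mathscr{R}:\ell^2(\mathbb{Z}^+)\to\mathcal{H}$ such that $\mathscr{R}(\{\langle C^n f,u\rangle\}_{n\ge0})=f$ for all $f\in\mathcal{H}$. *)

theory Defs
  imports "HOL-Analysis.Analysis"
begin

text \<open>
  A complex Hilbert space is a complete real inner product space together with a complex scalar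
  multiplication extending the real one and a sesquilinear form, linear in its first argument,
  whose real part is the given real inner product.  Positive definiteness of \<open>cinner\<close>
  and \<open>norm x = sqrt (Re (cinner x x))\<close> are inherited from \<^class>\<open>real_inner\<close>; topology
  and completeness are those of this norm.
\<close>

class complex_inner = real_inner +
  fixes scaleC :: "complex \<Rightarrow> 'a \<Rightarrow> 'a" (infixr "*\<^sub>C" 75)
    and cinner :: "'a \<Rightarrow> 'a \<Rightarrow> complex"
  assumes scaleC_add_right: "c *\<^sub>C (x + y) = c *\<^sub>C x + c *\<^sub>C y"
    and scaleC_add_left: "(c + d) *\<^sub>C x = c *\<^sub>C x + d *\<^sub>C x"
    and scaleC_scaleC: "c *\<^sub>C (d *\<^sub>C x) = (c * d) *\<^sub>C x"
    and scaleC_one: "1 *\<^sub>C x = x"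
    and scaleR_scaleC: "r *\<^sub>R x = complex_of_real r *\<^sub>C x"
    and cinner_commute: "cinner x y = cnj (cinner y x)"
    and cinner_add_left: "cinner (x + y) z = cinner x z + cinner y z"
    and cinner_scaleC_left: "cinner (c *\<^sub>C x) y = c * cinner x y"
    and inner_eq_Re_cinner: "inner x y = Re (cinner x y)"

class chilbert_space = complex_inner + banach

instantiation complex :: chilbert_space
begin

definition scaleC_complex :: "complex \<Rightarrow> complex \<Rightarrow> complex"
  where "scaleC_complex c x = c * x"

definition cinner_complex :: "complex \<Rightarrow> complex \<Rightarrow> complex"
  where "cinner_complex x y = x * cnj y"

instance
  by standard
    (simp_all add: scaleC_complex_def cinner_complex_def inner_complex_def scaleR_conv_of_real
      algebra_simps)

end

definition bounded_clinear :: "('a::complex_inner \<Rightarrow> 'a) \<Rightarrow> bool"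
  where "bounded_clinear A \<longleftrightarrow> bounded_linear A \<and> (\<forall>c x. A (c *\<^sub>C x) = c *\<^sub>C A x)"

text \<open>
  For a bounded operator on a Hilbert space the map chosen here exists by the Riesz representation
  theorem, and is unique.  The library's \<^const>\<open>adjoint\<close> refers to the real inner product.
\<close>

definition cadjoint :: "('a::complex_inner \<Rightarrow> 'a) \<Rightarrow> 'a \<Rightarrow> 'a"
  where "cadjoint A = (SOME A'. \<forall>x y. cinner (A x) y = cinner x (A' y))"

definition ell2 :: "(nat \<Rightarrow> complex) set"
  where "ell2 = {x. summable (\<lambda>n. (cmod (x n))\<^sup>2)}"

definition ell2_norm :: "(nat \<Rightarrow> complex) \<Rightarrow> real"
  where "ell2_norm x = sqrt (\<Sum>n. (cmod (x n))\<^sup>2)"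

text \<open>
  An operator on \<^const>\<open>ell2\<close> is a function on all sequences, of which only the values on
  \<^const>\<open>ell2\<close> matter.
\<close>

definition bounded_clinear_on_ell2 :: "((nat \<Rightarrow> complex) \<Rightarrow> 'a::complex_inner) \<Rightarrow> bool"
  where "bounded_clinear_on_ell2 R \<longleftrightarrow>
    (\<forall>x\<in>ell2. \<forall>y\<in>ell2. R (\<lambda>n. x n + y n) = R x + R y) \<and>
    (\<forall>c. \<forall>x\<in>ell2. R (\<lambda>n. c * x n) = c *\<^sub>C R x) \<and>
    (\<exists>K. \<forall>x\<in>ell2. norm (R x) \<le> K * ell2_norm x)"

definition samples :: "('a::complex_inner \<Rightarrow> 'a) \<Rightarrow> 'a \<Rightarrow> 'a \<Rightarrow> nat \<Rightarrow> complex"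
  where "samples C u f = (\<lambda>n. cinner ((C ^^ n) f) u)"

definition stably_recoverable :: "('a::complex_inner \<Rightarrow> 'a) \<Rightarrow> 'a \<Rightarrow> bool"
  where "stably_recoverable C u \<longleftrightarrow>
    (\<forall>f. samples C u f \<in> ell2) \<and>
    (\<exists>R. bounded_clinear_on_ell2 R \<and> (\<forall>f. R (samples C u f) = f))"

end

(*
  Put phi_n = (A^* )^n g and psi_n = (B^* )^n g, so that the samples of f are <f, phi_n> and
  <f, psi_n>.  By Young's inequality with weight epsilon the mixed term is absorbed, leaving
  |sum a_n (phi_n - psi_n)|^2 <= kappa |sum a_n phi_n|^2 + nu |sum a_n psi_n|^2 with kappa, nu < 1.
  By uniform boundedness phi is a Bessel sequence, and the inequality passes this on to psi.
  If R recovers f from <f, phi_n>, then f = sum c_n phi_n with c = R^* f.  Put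
  V f = R (<f, psi_n>)_n, so that sum c_n psi_n = V^* f.  The inequality now reads
  |f - V^* f|^2 <= kappa |f|^2 + nu |V^* f|^2, and expanding the square gives
  2 Re <V f, f> >= (1 - kappa) |f|^2.  A coercive operator is invertible, and V^{-1} R recovers f
  from <f, psi_n>.
*)
theory Submission
  imports Defs
begin

section \<open>Complex inner product spaces\<close>

lemma cinner_add_right: "cinner x (y + z) = cinner x y + cinner x (z::'a::complex_inner)"
  by (metis cinner_add_left cinner_commute complex_cnj_add)

lemma cinner_scaleC_right: "cinner x (c *\<^sub>C y) = cnj c * cinner x (y::'a::complex_inner)"
  by (metis cinner_scaleC_left cinner_commute complex_cnj_mult)

lemma cinner_zero_left [simp]: "cinner 0 (y::'a::complex_inner) = 0"
  by (metis add_cancel_right_right cinner_add_left)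

lemma cinner_zero_right [simp]: "cinner (y::'a::complex_inner) 0 = 0"
  by (metis add_cancel_right_right cinner_add_right)

lemma scaleC_zero_left [simp]: "0 *\<^sub>C (x::'a::complex_inner) = 0"
  by (metis of_real_0 scaleR_scaleC scaleR_zero_left)

lemma scaleC_diff_right: "c *\<^sub>C (x - y) = c *\<^sub>C x - c *\<^sub>C (y::'a::complex_inner)"
  by (metis add_diff_cancel diff_add_cancel scaleC_add_right)

lemma cinner_sum_left: "cinner (\<Sum>n\<in>S. f n) (y::'a::complex_inner) = (\<Sum>n\<in>S. cinner (f n) y)"
  by (induction S rule: infinite_finite_induct) (simp_all add: cinner_add_left)

lemma cinner_sum_right: "cinner (y::'a::complex_inner) (\<Sum>n\<in>S. f n) = (\<Sum>n\<in>S. cinner y (f n))"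
  by (induction S rule: infinite_finite_induct) (simp_all add: cinner_add_right)

text \<open>Conjugate symmetry makes \<open>cinner x x\<close> equal to its own conjugate, hence
  real, and its real part is the inherited inner product.\<close>

lemma cinner_same: "cinner x x = complex_of_real ((norm (x::'a::complex_inner))\<^sup>2)"
proof (rule complex_eqI)
  show "Re (cinner x x) = Re (complex_of_real ((norm x)\<^sup>2))"
    by (metis Re_complex_of_real inner_eq_Re_cinner power2_norm_eq_inner)
  have "Im (cinner x x) = - Im (cinner x x)"
    by (metis cinner_commute cnj.simps(2))
  then show "Im (cinner x x) = Im (complex_of_real ((norm x)\<^sup>2))" by simp
qed

lemma norm_scaleC: "norm (c *\<^sub>C (x::'a::complex_inner)) = cmod c * norm x"
proof -
  have "cinner (c *\<^sub>C x) (c *\<^sub>C x) = (c * cnj c) * cinner x x"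
    by (simp add: cinner_scaleC_left cinner_scaleC_right)
  then have "complex_of_real ((norm (c *\<^sub>C x))\<^sup>2) = complex_of_real ((cmod c * norm x)\<^sup>2)"
    by (simp add: cinner_same complex_norm_square power_mult_distrib del: of_real_power)
  then have "(norm (c *\<^sub>C x))\<^sup>2 = (cmod c * norm x)\<^sup>2"
    using of_real_eq_iff by blast
  then show ?thesis by simp
qed

text \<open>Multiplying \<open>x\<close> by a suitable scalar of modulus 1 makes the product real
  and nonnegative without changing \<open>norm x\<close>, so the real Cauchy-Schwarz inequality
  applies.\<close>

lemma cmod_cinner_le: "cmod (cinner x y) \<le> norm x * norm (y::'a::complex_inner)"
proof (cases "cinner x y = 0")
  case False
  define c where "c = cnj (cinner x y) / cmod (cinner x y)"
  have c: "cmod c = 1" using False by (simp add: c_def norm_divide)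
  have "cinner (c *\<^sub>C x) y = complex_of_real (cmod (cinner x y))"
    using False complex_norm_square[of "cinner x y"]
    by (simp add: cinner_scaleC_left c_def field_simps power2_eq_square)
  then have "cmod (cinner x y) = inner (c *\<^sub>C x) y"
    by (simp add: inner_eq_Re_cinner)
  also have "\<dots> \<le> norm (c *\<^sub>C x) * norm y" by (rule norm_cauchy_schwarz)
  finally show ?thesis by (simp add: norm_scaleC c)
qed simp

lemma cinner_eqI:
  assumes "\<And>h. cinner h x = cinner h (y::'a::complex_inner)"
  shows "x = y"
  unfolding vector_eq_ldot[symmetric, of x y] by (simp add: inner_eq_Re_cinner assms)

lemma bounded_linear_cinner_left: "bounded_linear (\<lambda>x. cinner x (y::'a::complex_inner))"
proof (rule bounded_linear_intro[where K = "norm y"])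
  show "cinner (r *\<^sub>R x) y = r *\<^sub>R cinner x y" for r x
    by (simp only: scaleR_scaleC[of r x] cinner_scaleC_left scaleR_conv_of_real)
qed (auto simp: cinner_add_left cmod_cinner_le)

lemma bounded_linear_cinner_right: "bounded_linear (\<lambda>y. cinner x (y::'a::complex_inner))"
proof (rule bounded_linear_intro[where K = "norm x"])
  show "cinner x (r *\<^sub>R y) = r *\<^sub>R cinner x y" for r y
    by (simp add: scaleR_scaleC[of r y] cinner_scaleC_right scaleR_conv_of_real)
  show "norm (cinner x y) \<le> norm y * norm x" for y
    using cmod_cinner_le[of x y] by (simp only: mult.commute)
qed (rule cinner_add_right)

section \<open>Riesz representation and adjoints\<close>

text \<open>The representing vector minimises \<open>\<parallel>x\<parallel>\<^sup>2 - 2 f x\<close>; minimising sequences are Cauchy by the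
  parallelogram law.\<close>

lemma Riesz_representation:
  fixes f :: "'a::{real_inner,banach} \<Rightarrow> real"
  assumes "bounded_linear f"
  shows "\<exists>z. \<forall>x. f x = inner x z"
proof -
  interpret f: bounded_linear f by fact
  define J where "J x = (norm x)\<^sup>2 - 2 * f x" for x
  obtain K where K: "\<And>x. norm (f x) \<le> norm x * K" using f.bounded by blast
  have J_ge: "J x \<ge> - K\<^sup>2" for x
  proof -
    have "f x \<le> norm x * K" using K[of x] by simp
    moreover have "0 \<le> (norm x - K)\<^sup>2" by simp
    ultimately show ?thesis by (simp add: J_def power2_eq_square algebra_simps)
  qed
  define m where "m = (INF x. J x)"
  have bdd: "bdd_below (range J)" using J_ge by (auto simp: bdd_below_def)
  have m_le: "m \<le> J x" for x unfolding m_def by (rule cINF_lower[OF bdd]) simp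
  have "\<exists>x. J x < m + 1 / real (Suc n)" for n
  proof -
    have "Inf (range J) < m + 1 / real (Suc n)" by (simp add: m_def)
    then show ?thesis using cInf_lessD[of "range J"] by auto
  qed
  then obtain u where u: "\<And>n. J (u n) < m + 1 / real (Suc n)" by metis
  \<comment> \<open>The midpoint of \<open>x\<close> and \<open>y\<close> also has value at least
    \<open>m\<close>, so two near-minimisers of \<open>J\<close> must be close to each
    other.\<close>
  have parallelogram: "(norm (x - y))\<^sup>2 \<le> 2 * (J x - m) + 2 * (J y - m)" for x y
  proof -
    have "J x + J y - 2 * J ((1/2) *\<^sub>R (x + y)) = (norm (x - y))\<^sup>2 / 2"
      unfolding J_def power2_norm_eq_inner
      by (simp add: f.add f.scaleR inner_simps inner_commute[of y x] algebra_simps)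
    then show ?thesis using m_le[of "(1/2) *\<^sub>R (x + y)"] by argo
  qed
  have "Cauchy u"
  proof (rule metric_CauchyI)
    fix e :: real assume "e > 0"
    obtain N where N: "1 / real (Suc N) < e\<^sup>2 / 4"
      using \<open>e > 0\<close> reals_Archimedean[of "e\<^sup>2 / 4"] by (auto simp: field_simps)
    have "dist (u i) (u j) < e" if "i \<ge> N" "j \<ge> N" for i j
    proof -
      have "1 / real (Suc i) \<le> 1 / real (Suc N)" "1 / real (Suc j) \<le> 1 / real (Suc N)"
        using that by (simp_all add: field_simps)
      then have "(norm (u i - u j))\<^sup>2 < e\<^sup>2"
        using parallelogram[of "u i" "u j"] u[of i] u[of j] N by argo
      then show ?thesis using \<open>e > 0\<close> power2_less_imp_less[of "norm (u i - u j)" e]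
        by (simp add: dist_norm)
    qed
    then show "\<exists>M. \<forall>i\<ge>M. \<forall>j\<ge>M. dist (u i) (u j) < e" by blast
  qed
  then obtain z where z: "u \<longlonglongrightarrow> z" using Cauchy_convergent_iff convergent_def by blast
  have "J z \<le> m + 0"
  proof (rule LIMSEQ_le)
    show "(\<lambda>n. J (u n)) \<longlonglongrightarrow> J z"
      unfolding J_def by (intro tendsto_intros z f.tendsto)
    show "(\<lambda>n. m + 1 / real (Suc n)) \<longlonglongrightarrow> m + 0"
      by (intro tendsto_add tendsto_const LIMSEQ_Suc[OF lim_1_over_n])
    show "\<exists>N. \<forall>n\<ge>N. J (u n) \<le> m + 1 / real (Suc n)"
      using u less_imp_le by blast
  qed
  then have Jz: "J z \<le> m" by simp
  have "f x = inner x z" for x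
  proof -
    define d where "d = inner x z - f x"
    have *: "0 \<le> t\<^sup>2 * (norm x)\<^sup>2 + 2 * t * d" for t
    proof -
      have "J (z + t *\<^sub>R x) = J z + t\<^sup>2 * (norm x)\<^sup>2 + 2 * t * d"
        unfolding J_def d_def power2_norm_eq_inner
        by (simp add: f.add f.scaleR inner_simps inner_commute power2_eq_square algebra_simps)
      then show ?thesis using m_le[of "z + t *\<^sub>R x"] Jz by linarith
    qed
    \<comment> \<open>Testing minimality at \<open>t = - d / q\<close> yields a negative value
      unless \<open>d = 0\<close>. The summand 1 keeps \<open>q\<close> positive even when
      \<open>x = 0\<close>.\<close>
    define q where "q = 1 + (norm x)\<^sup>2"
    have "q > 0" by (simp add: q_def add_pos_nonneg)
    have "0 \<le> (- d / q)\<^sup>2 * (norm x)\<^sup>2 + 2 * (- d / q) * d" by (rule *)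
    also have "\<dots> = (d\<^sup>2 / q\<^sup>2) * ((norm x)\<^sup>2 - 2 * q)"
      using \<open>q > 0\<close> by (simp add: field_simps power2_eq_square)
    finally have "0 \<le> (d\<^sup>2 / q\<^sup>2) * ((norm x)\<^sup>2 - 2 * q)" .
    moreover have "(norm x)\<^sup>2 - 2 * q < 0"
      unfolding q_def using zero_le_power2[of "norm x"] by argo
    ultimately have "\<not> 0 < d\<^sup>2 / q\<^sup>2" using mult_pos_neg leD by blast
    moreover have "0 < d\<^sup>2 / q\<^sup>2" if "d \<noteq> 0" using that \<open>q > 0\<close> by simp
    ultimately have "d = 0" by blast
    then show ?thesis by (simp add: d_def)
  qed
  then show ?thesis by blast
qed

text \<open>\<open>cadjoint\<close> is a choice, so a witness must be produced. Real Riesz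
  representation matches the real parts of the two products; evaluating it at
  \<open>\<i> *\<^sub>C x\<close> matches the imaginary parts, since \<open>A\<close> commutes with
  \<open>\<i>\<close>.\<close>

lemma cinner_cadjoint:
  fixes A :: "'a::chilbert_space \<Rightarrow> 'a"
  assumes "bounded_clinear A"
  shows "cinner (A x) y = cinner x (cadjoint A y)"
proof -
  interpret A: bounded_linear A using assms by (simp add: bounded_clinear_def)
  have A_scaleC: "A (c *\<^sub>C x) = c *\<^sub>C A x" for c x using assms by (simp add: bounded_clinear_def)
  have "\<exists>z. \<forall>x. cinner (A x) y = cinner x z" for y
  proof -
    have "bounded_linear (\<lambda>x. inner (A x) y)"
      by (intro bounded_linear_compose[OF bounded_linear_inner_left] A.bounded_linear_axioms)
    then obtain z where z: "\<And>x. inner (A x) y = inner x z"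
      using Riesz_representation by blast
    have "cinner (A x) y = cinner x z" for x
    proof (rule complex_eqI)
      show "Re (cinner (A x) y) = Re (cinner x z)"
        using z[of x] by (simp add: inner_eq_Re_cinner)
      show "Im (cinner (A x) y) = Im (cinner x z)"
        using z[of "\<i> *\<^sub>C x"] by (simp add: inner_eq_Re_cinner A_scaleC cinner_scaleC_left)
    qed
    then show ?thesis by blast
  qed
  then have "\<exists>A'. \<forall>x y. cinner (A x) y = cinner x (A' y)" by metis
  then show ?thesis unfolding cadjoint_def by (rule someI2_ex) blast
qed

text \<open>This turns samples along an orbit of \<open>A\<close> into coefficients against a fixed
  sequence of vectors. The main argument then concerns two sequences only and no longer mentions
  operator powers.\<close>

lemma samples_eq_cinner_cadjoint:
  fixes A :: "'a::chilbert_space \<Rightarrow> 'a"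
  assumes "bounded_clinear A"
  shows "samples A g f n = cinner f ((cadjoint A ^^ n) g)"
proof -
  have "cinner ((A ^^ n) f) g = cinner f ((cadjoint A ^^ n) g)" for g
  proof (induction n arbitrary: g)
    case (Suc n)
    then show ?case using cinner_cadjoint[OF assms]
      by (metis comp_apply funpow.simps(2) funpow_Suc_right)
  qed simp
  then show ?thesis by (simp add: samples_def)
qed

section \<open>Coercive operators and uniform boundedness\<close>

text \<open>Solving \<open>V x = y\<close> is a fixed point problem for \<open>x \<mapsto> x - t (V x - y)\<close>, a contraction for small
  \<open>t > 0\<close>.\<close>

lemma coercive_bij:
  fixes V :: "'a::{real_inner,banach} \<Rightarrow> 'a"
  assumes "bounded_linear V" and "\<alpha> > 0" and coercive: "\<And>x. \<alpha> * (norm x)\<^sup>2 \<le> inner (V x) x"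
  shows "bij V" and "\<alpha> * norm x \<le> norm (V x)"
proof -
  interpret V: bounded_linear V by fact
  show below: "\<alpha> * norm x \<le> norm (V x)" for x
  proof (cases "x = 0")
    case False
    have "\<alpha> * norm x * norm x \<le> norm (V x) * norm x"
      using coercive[of x] norm_cauchy_schwarz[of "V x" x] by (simp add: power2_eq_square)
    then show ?thesis using False by simp
  qed (simp add: V.zero)
  have "inj V"
  proof (rule injI)
    fix x y assume "V x = V y"
    then have "\<alpha> * norm (x - y) \<le> 0" using below[of "x - y"] by (simp add: V.diff)
    then show "x = y" using \<open>\<alpha> > 0\<close> by (simp add: mult_le_0_iff)
  qed
  moreover have "\<exists>x. V x = y" for y
  proof -
    obtain K where "K > 0" and K: "\<And>x. norm (V x) \<le> norm x * K" using V.pos_bounded by blast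
    \<comment> \<open>Adding \<open>\<alpha>\<close> ensures \<open>\<alpha> < M\<close>, which
      keeps the radicand in \<open>c\<close> below nonnegative.\<close>
    define M where "M = K + \<alpha>"
    have "M > 0" and "\<alpha> < M" using \<open>K > 0\<close> \<open>\<alpha> > 0\<close> by (auto simp: M_def)
    have M: "norm (V x) \<le> M * norm x" for x
      using K[of x] \<open>\<alpha> > 0\<close> by (simp add: M_def algebra_simps add_increasing2)
    \<comment> \<open>This \<open>t\<close> minimises
      \<open>1 - 2 * t * \<alpha> + t\<^sup>2 * M\<^sup>2\<close>, and the minimum is the square of
      the contraction constant \<open>c\<close>.\<close>
    define t where "t = \<alpha> / M\<^sup>2"
    have "t > 0" using \<open>\<alpha> > 0\<close> \<open>M > 0\<close> by (simp add: t_def)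
    define c where "c = sqrt (1 - \<alpha>\<^sup>2 / M\<^sup>2)"
    have q: "0 < \<alpha>\<^sup>2 / M\<^sup>2" "\<alpha>\<^sup>2 / M\<^sup>2 \<le> 1"
      using \<open>\<alpha> > 0\<close> \<open>\<alpha> < M\<close> by (auto simp: divide_le_eq power2_eq_square mult_mono)
    then have c: "0 \<le> c" "c < 1" by (auto simp: c_def)
    have contraction: "norm (x - t *\<^sub>R V x) \<le> c * norm x" for x
    proof -
      have "(norm (x - t *\<^sub>R V x))\<^sup>2 = (norm x)\<^sup>2 - 2 * t * inner (V x) x + t\<^sup>2 * (norm (V x))\<^sup>2"
        unfolding power2_norm_eq_inner
        by (simp add: inner_simps inner_commute power2_eq_square algebra_simps)
      also have "\<dots> \<le> (norm x)\<^sup>2 - 2 * t * (\<alpha> * (norm x)\<^sup>2) + t\<^sup>2 * (M * norm x)\<^sup>2"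
        using \<open>t > 0\<close> coercive[of x] M[of x]
        by (intro add_mono diff_mono mult_left_mono power_mono) auto
      also have "\<dots> = (1 - \<alpha>\<^sup>2 / M\<^sup>2) * (norm x)\<^sup>2"
        using \<open>M > 0\<close> by (simp add: t_def power2_eq_square field_simps)
      also have "\<dots> = (c * norm x)\<^sup>2"
        using q by (simp add: c_def power_mult_distrib)
      finally show ?thesis by (rule power2_le_imp_le) (use c in simp)
    qed
    have "\<exists>!x. x - t *\<^sub>R (V x - y) = x"
    proof (rule banach_fix_type[OF c], intro allI)
      fix x x'
      have "x - t *\<^sub>R (V x - y) - (x' - t *\<^sub>R (V x' - y)) = (x - x') - t *\<^sub>R V (x - x')"
        unfolding V.diff scaleR_diff_right by simp
      then show "dist (x - t *\<^sub>R (V x - y)) (x' - t *\<^sub>R (V x' - y)) \<le> c * dist x x'"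
        unfolding dist_norm using contraction[of "x - x'"] by metis
    qed
    then show ?thesis using \<open>t > 0\<close> by auto
  qed
  ultimately show "bij V" unfolding bij_def surj_def by metis
qed

text \<open>Uniform boundedness by Baire category: the closed sets \<open>F k\<close> cover the
  space, so one of them contains a ball. It is stated for seminorms because it will be applied to
  truncated square-sum norms, which are not linear functionals.\<close>

lemma seminorms_uniformly_bounded:
  fixes p :: "nat \<Rightarrow> 'a::banach \<Rightarrow> real"
  assumes cont: "\<And>i. continuous_on UNIV (p i)"
    and add: "\<And>i x y. p i (x + y) \<le> p i x + p i y"
    and scale: "\<And>i r x. p i (r *\<^sub>R x) = \<bar>r\<bar> * p i x"
    and pointwise: "\<And>x. \<exists>K. \<forall>i. p i x \<le> K"
  shows "\<exists>K\<ge>0. \<forall>i x. p i x \<le> K * norm x"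
proof -
  define F where "F k = {x. \<forall>i. p i x \<le> real k}" for k
  have "closed (F k)" for k
  proof -
    have "F k = (\<Inter>i. {x. p i x \<le> real k})" by (auto simp: F_def)
    moreover have "closed {x. p i x \<le> real k}" for i
      using cont by (intro closed_Collect_le continuous_on_const) auto
    ultimately show ?thesis by auto
  qed
  moreover have "\<exists>k. x \<in> F k" for x
  proof -
    obtain K where K: "\<And>i. p i x \<le> K" using pointwise by blast
    obtain k where "K \<le> real k" using real_arch_simple by blast
    then have "x \<in> F k" unfolding F_def using order_trans[OF K] by blast
    then show ?thesis ..
  qed
  then have "\<Union>(range F) = UNIV" by blast
  then have "interior (\<Union>(range F)) \<noteq> {}" by simp
  ultimately obtain k where "interior (F k) \<noteq> {}"
    using Baire_category_alt[of "euclidean :: 'a topology" "range F"]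
    by (auto simp: completely_metrizable_space_euclidean)
  then obtain x0 where "x0 \<in> interior (F k)" by blast
  then obtain r where "r > 0" and r: "cball x0 r \<subseteq> F k"
    by (meson mem_interior_cball)
  have "p i x \<le> (2 * real k / r) * norm x" for i x
  proof (cases "x = 0")
    case True
    then show ?thesis using scale[of i 0 x] by simp
  next
    case False
    \<comment> \<open>\<open>x\<close> is rescaled to the radius of the ball. Writing
      \<open>h\<close> as the difference of \<open>x0 + h\<close> and \<open>x0\<close>, both in
      \<open>F k\<close>, gives the bound \<open>2 * real k\<close>.\<close>
    define h where "h = (r / norm x) *\<^sub>R x"
    have "norm h = r" using False \<open>r > 0\<close> by (simp add: h_def)
    then have "x0 + h \<in> cball x0 r" "x0 \<in> cball x0 r" using \<open>r > 0\<close> by (auto simp: dist_norm)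
    then have "x0 + h \<in> F k" "x0 \<in> F k" using r by blast+
    then have *: "p i (x0 + h) \<le> k" "p i x0 \<le> k" by (auto simp: F_def)
    have "p i h \<le> p i (x0 + h) + p i ((-1) *\<^sub>R x0)" using add[of i "x0 + h" "(-1) *\<^sub>R x0"] by simp
    also have "\<dots> \<le> 2 * real k" unfolding scale using * by simp
    finally have "r / norm x * p i x \<le> 2 * real k"
      using \<open>r > 0\<close> by (simp add: h_def scale)
    then show ?thesis using False \<open>r > 0\<close> by (simp add: field_simps)
  qed
  moreover have "2 * real k / r \<ge> 0" using \<open>r > 0\<close> by simp
  ultimately show ?thesis by blast
qed

section \<open>Operators on square-summable sequences\<close>

lemma L2_set_le_ell2_norm:
  assumes "x \<in> ell2" "finite S"
  shows "L2_set (\<lambda>n. cmod (x n)) S \<le> ell2_norm x"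
  using assms unfolding L2_set_def ell2_norm_def ell2_def
  by (auto intro!: sum_le_suminf)

lemma ell2_boundedI:
  assumes "\<And>l. L2_set (\<lambda>n. cmod (x n)) {..<l} \<le> K"
  shows "x \<in> ell2" and "ell2_norm x \<le> K"
proof -
  \<comment> \<open>The empty partial sum already forces the bound to be nonnegative.\<close>
  have "0 \<le> K" using assms[of 0] by simp
  have le: "(\<Sum>n<l. (cmod (x n))\<^sup>2) \<le> K\<^sup>2" for l
    using assms[of l] unfolding L2_set_def by (rule sqrt_le_D)
  then have sm: "summable (\<lambda>n. (cmod (x n))\<^sup>2)"
    by (intro summableI_nonneg_bounded) auto
  then show "x \<in> ell2" by (simp add: ell2_def)
  have "(\<Sum>n. (cmod (x n))\<^sup>2) \<le> K\<^sup>2" using sm le by (rule suminf_le_const)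
  then show "ell2_norm x \<le> K"
    unfolding ell2_norm_def using \<open>0 \<le> K\<close> by (intro real_le_lsqrt)
qed

lemma ell2_truncation:
  assumes "finite S"
  shows "(\<lambda>n. if n \<in> S then x n else 0) \<in> ell2"
    and "ell2_norm (\<lambda>n. if n \<in> S then x n else 0) = L2_set (\<lambda>n. cmod (x n)) S"
proof -
  have eq: "(\<lambda>n. (cmod (if n \<in> S then x n else 0))\<^sup>2) = (\<lambda>n. if n \<in> S then (cmod (x n))\<^sup>2 else 0)"
    by auto
  have "(\<lambda>n. if n \<in> S then (cmod (x n))\<^sup>2 else 0) sums (\<Sum>n\<in>S. (cmod (x n))\<^sup>2)"
    by (rule sums_If_finite_set[OF assms])
  then show "(\<lambda>n. if n \<in> S then x n else 0) \<in> ell2"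
    and "ell2_norm (\<lambda>n. if n \<in> S then x n else 0) = L2_set (\<lambda>n. cmod (x n)) S"
    unfolding ell2_def ell2_norm_def L2_set_def mem_Collect_eq eq
    by (auto simp: sums_iff)
qed

text \<open>The squared norm of a tail is the full sum minus a partial sum. The conditional is the
  complement of the one in \<open>ell2_truncation\<close>, so that truncation and tail add up to
  \<open>x\<close> pointwise.\<close>

lemma ell2_tail:
  assumes "x \<in> ell2"
  shows "(\<lambda>n. if n \<in> {..<l} then 0 else x n) \<in> ell2"
    and "(\<lambda>l. ell2_norm (\<lambda>n. if n \<in> {..<l} then 0 else x n)) \<longlonglongrightarrow> 0"
proof -
  define s where "s = (\<Sum>n. (cmod (x n))\<^sup>2)"
  have s: "(\<lambda>n. (cmod (x n))\<^sup>2) sums s"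
    using assms by (simp add: s_def ell2_def summable_sums)
  have tail: "(\<lambda>n. (cmod (if n \<in> {..<l} then 0 else x n))\<^sup>2) sums (s - (\<Sum>n<l. (cmod (x n))\<^sup>2))" for l
  proof -
    have eq: "(\<lambda>n. (cmod (if n \<in> {..<l} then 0 else x n))\<^sup>2)
      = (\<lambda>n. (cmod (x n))\<^sup>2 - (if n \<in> {..<l} then (cmod (x n))\<^sup>2 else 0))"
      by auto
    show ?thesis unfolding eq by (intro sums_diff s sums_If_finite_set) simp
  qed
  then show "(\<lambda>n. if n \<in> {..<l} then 0 else x n) \<in> ell2"
    unfolding ell2_def by (blast intro: sums_summable)
  have "(\<lambda>l. sqrt (s - (\<Sum>n<l. (cmod (x n))\<^sup>2))) \<longlonglongrightarrow> sqrt (s - s)"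
    using s unfolding sums_def by (intro tendsto_intros)
  moreover have "ell2_norm (\<lambda>n. if n \<in> {..<l} then 0 else x n) = sqrt (s - (\<Sum>n<l. (cmod (x n))\<^sup>2))" for l
    unfolding ell2_norm_def using tail[of l] by (simp only: sums_iff)
  ultimately show "(\<lambda>l. ell2_norm (\<lambda>n. if n \<in> {..<l} then 0 else x n)) \<longlonglongrightarrow> 0" by simp
qed

definition unit_seq :: "nat \<Rightarrow> nat \<Rightarrow> complex"
  where "unit_seq n = (\<lambda>k. if k = n then 1 else 0)"

context
  fixes R :: "(nat \<Rightarrow> complex) \<Rightarrow> 'a::chilbert_space"
  assumes R: "bounded_clinear_on_ell2 R"
begin

lemma ell2_operator_add: "x \<in> ell2 \<Longrightarrow> y \<in> ell2 \<Longrightarrow> R (\<lambda>n. x n + y n) = R x + R y"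
  using R by (simp add: bounded_clinear_on_ell2_def)

lemma ell2_operator_scale: "x \<in> ell2 \<Longrightarrow> R (\<lambda>n. c * x n) = c *\<^sub>C R x"
  using R by (simp add: bounded_clinear_on_ell2_def)

text \<open>The definition allows a negative \<open>K\<close>; replacing it by
  \<open>max K 0\<close> makes it usable in monotonicity arguments and as a Bessel constant.\<close>

lemma ell2_operator_bounded:
  obtains K where "0 \<le> K" "\<And>x. x \<in> ell2 \<Longrightarrow> norm (R x) \<le> K * ell2_norm x"
proof -
  obtain K where K: "\<And>x. x \<in> ell2 \<Longrightarrow> norm (R x) \<le> K * ell2_norm x"
    using R unfolding bounded_clinear_on_ell2_def by blast
  have "norm (R x) \<le> max K 0 * ell2_norm x" if "x \<in> ell2" for x
  proof -
    have "0 \<le> ell2_norm x"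
      using L2_set_le_ell2_norm[OF that, of "{}"] by simp
    then have "K * ell2_norm x \<le> max K 0 * ell2_norm x" by (intro mult_right_mono) simp_all
    then show ?thesis using K[OF that] by simp
  qed
  then show ?thesis using that[of "max K 0"] by simp
qed

text \<open>Linearity is available only on \<open>ell2\<close>, so the induction also certifies that
  each summand lies there.\<close>

lemma ell2_operator_truncation:
  assumes "finite S"
  shows "R (\<lambda>n. if n \<in> S then x n else 0) = (\<Sum>n\<in>S. x n *\<^sub>C R (unit_seq n))"
  using assms
proof induction
  case empty
  have "(\<lambda>n. 0) \<in> ell2" by (simp add: ell2_def)
  then show ?case using ell2_operator_scale[of "\<lambda>n. 0" 0] by simp
next
  case (insert m S)
  have unit: "unit_seq m \<in> ell2"
    using ell2_truncation(1)[of "{m}" "\<lambda>_. 1"] by (simp add: unit_seq_def)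
  have scaled: "(\<lambda>n. x m * unit_seq m n) \<in> ell2"
    using ell2_truncation(1)[of "{m}" "\<lambda>_. x m"] by (simp add: unit_seq_def if_distrib cong: if_cong)
  have "(\<lambda>n. if n \<in> insert m S then x n else 0)
      = (\<lambda>n. x m * unit_seq m n + (if n \<in> S then x n else 0))"
    using insert.hyps by (auto simp: unit_seq_def fun_eq_iff)
  then have "R (\<lambda>n. if n \<in> insert m S then x n else 0)
      = R (\<lambda>n. x m * unit_seq m n) + R (\<lambda>n. if n \<in> S then x n else 0)"
    using ell2_operator_add[OF scaled ell2_truncation(1)[OF insert.hyps(1), of x]] by simp
  then show ?case using insert by (simp add: ell2_operator_scale[OF unit])
qed

text \<open>The error is the image of a tail, and boundedness of \<open>R\<close> carries the decay
  of tails over to the target space. Thus \<open>R\<close> is determined by its values on the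
  standard basis.\<close>

lemma ell2_operator_truncation_tendsto:
  assumes "x \<in> ell2"
  shows "(\<lambda>l. \<Sum>n<l. x n *\<^sub>C R (unit_seq n)) \<longlonglongrightarrow> R x"
proof -
  obtain K where R_bound: "\<And>x. x \<in> ell2 \<Longrightarrow> norm (R x) \<le> K * ell2_norm x"
    using ell2_operator_bounded by blast
  have "norm ((\<Sum>n<l. x n *\<^sub>C R (unit_seq n)) - R x)
      \<le> K * ell2_norm (\<lambda>n. if n \<in> {..<l} then 0 else x n)" for l
  proof -
    have "R (\<lambda>n. (if n \<in> {..<l} then x n else 0) + (if n \<in> {..<l} then 0 else x n))
        = (\<Sum>n<l. x n *\<^sub>C R (unit_seq n)) + R (\<lambda>n. if n \<in> {..<l} then 0 else x n)"
      unfolding ell2_operator_truncation[OF finite_lessThan, symmetric]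
      by (intro ell2_operator_add ell2_truncation(1) ell2_tail(1) assms) simp
    moreover have "(\<lambda>n. (if n \<in> {..<l} then x n else 0) + (if n \<in> {..<l} then 0 else x n)) = x"
      by auto
    ultimately have "(\<Sum>n<l. x n *\<^sub>C R (unit_seq n)) - R x
        = - R (\<lambda>n. if n \<in> {..<l} then 0 else x n)"
      by simp
    then show ?thesis using R_bound[OF ell2_tail(1)[OF assms, of l]] by simp
  qed
  then have "\<forall>\<^sub>F l in sequentially. norm ((\<Sum>n<l. x n *\<^sub>C R (unit_seq n)) - R x)
      \<le> K * ell2_norm (\<lambda>n. if n \<in> {..<l} then 0 else x n)"
    by (rule always_eventually[OF allI])
  then have "(\<lambda>l. (\<Sum>n<l. x n *\<^sub>C R (unit_seq n)) - R x) \<longlonglongrightarrow> 0"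
    by (rule Lim_null_comparison) (rule tendsto_mult_right_zero[OF ell2_tail(2)[OF assms]])
  then show ?thesis by (rule LIM_zero_cancel)
qed

end

section \<open>Bessel sequences\<close>

text \<open>\<open>K\<close> bounds the norm of the analysis operator, so the Bessel bound in the
  usual squared convention is the square of \<open>K\<close>.\<close>

definition bessel :: "real \<Rightarrow> (nat \<Rightarrow> 'a::complex_inner) \<Rightarrow> bool"
  where "bessel K x \<longleftrightarrow> 0 \<le> K \<and>
    (\<forall>f. (\<lambda>n. cinner f (x n)) \<in> ell2 \<and> ell2_norm (\<lambda>n. cinner f (x n)) \<le> K * norm f)"

text \<open>Synthesis is adjoint to analysis and so has the same norm. Concretely, the sum is paired
  with itself, Cauchy-Schwarz is applied to the coefficients, and one factor \<open>norm s\<close>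
  cancels.\<close>

lemma synthesis_le:
  fixes x :: "nat \<Rightarrow> 'a::complex_inner"
  assumes analysis: "\<And>f. L2_set (\<lambda>n. cmod (cinner f (x n))) S \<le> K * norm f"
    and "0 \<le> K"
  shows "norm (\<Sum>n\<in>S. a n *\<^sub>C x n) \<le> K * L2_set (\<lambda>n. cmod (a n)) S"
proof -
  define s where "s = (\<Sum>n\<in>S. a n *\<^sub>C x n)"
  have "norm s * norm s = cmod (cinner s s)"
    by (simp add: cinner_same power2_eq_square norm_mult)
  also have "cinner s s = (\<Sum>n\<in>S. a n * cinner (x n) s)"
    by (subst s_def) (simp add: cinner_sum_left cinner_scaleC_left)
  also have "cmod \<dots> \<le> (\<Sum>n\<in>S. \<bar>cmod (a n)\<bar> * \<bar>cmod (cinner s (x n))\<bar>)"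
    by (rule sum_norm_le) (simp add: norm_mult cinner_commute[of s])
  also have "\<dots> \<le> L2_set (\<lambda>n. cmod (a n)) S * L2_set (\<lambda>n. cmod (cinner s (x n))) S"
    by (rule L2_set_mult_ineq)
  also have "\<dots> \<le> L2_set (\<lambda>n. cmod (a n)) S * (K * norm s)"
    by (intro mult_left_mono analysis L2_set_nonneg)
  finally have le: "norm s * norm s \<le> (K * L2_set (\<lambda>n. cmod (a n)) S) * norm s"
    by (simp add: mult_ac)
  show ?thesis
  proof (cases "s = 0")
    case True
    then show ?thesis using \<open>0 \<le> K\<close> by (simp add: s_def L2_set_nonneg)
  next
    case False
    then show ?thesis using le by (simp add: s_def)
  qed
qed

text \<open>The converse half of the duality: the coefficients \<open>a n\<close> are taken to be
  \<open>cinner f (x n)\<close>, and one factor \<open>L\<close> cancels.\<close>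

lemma analysis_le:
  fixes x :: "nat \<Rightarrow> 'a::complex_inner"
  assumes synthesis: "\<And>a. norm (\<Sum>n\<in>S. a n *\<^sub>C x n) \<le> K * L2_set (\<lambda>n. cmod (a n)) S"
    and "0 \<le> K"
  shows "L2_set (\<lambda>n. cmod (cinner f (x n))) S \<le> K * norm f"
proof -
  define L where "L = L2_set (\<lambda>n. cmod (cinner f (x n))) S"
  have "complex_of_real (L\<^sup>2) = (\<Sum>n\<in>S. complex_of_real ((cmod (cinner f (x n)))\<^sup>2))"
    by (simp add: L_def L2_set_def sum_nonneg)
  also have "\<dots> = (\<Sum>n\<in>S. cinner f (cinner f (x n) *\<^sub>C x n))"
    by (intro sum.cong refl) (simp add: cinner_scaleC_right complex_norm_square mult.commute del: of_real_power)
  also have "\<dots> = cinner f (\<Sum>n\<in>S. cinner f (x n) *\<^sub>C x n)" by (rule cinner_sum_right[symmetric])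
  finally have "L\<^sup>2 = cmod (cinner f (\<Sum>n\<in>S. cinner f (x n) *\<^sub>C x n))"
    by (metis abs_of_nonneg norm_of_real zero_le_power2)
  also have "\<dots> \<le> norm f * norm (\<Sum>n\<in>S. cinner f (x n) *\<^sub>C x n)" by (rule cmod_cinner_le)
  also have "\<dots> \<le> norm f * (K * L)" unfolding L_def by (intro mult_left_mono synthesis) simp
  finally have le: "L * L \<le> (K * norm f) * L" by (simp add: power2_eq_square mult_ac)
  have "0 \<le> L" by (simp add: L_def L2_set_nonneg)
  then have "L \<le> K * norm f"
    using le \<open>0 \<le> K\<close> by (cases "L = 0") auto
  then show ?thesis by (simp add: L_def)
qed

text \<open>The perturbation hypothesis speaks about finite linear combinations, so the Bessel
  property has to be obtained from the synthesis side.\<close>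

lemma besselI:
  fixes x :: "nat \<Rightarrow> 'a::complex_inner"
  assumes "0 \<le> K"
    and "\<And>l a. norm (\<Sum>n<l. a n *\<^sub>C x n) \<le> K * L2_set (\<lambda>n. cmod (a n)) {..<l}"
  shows "bessel K x"
proof -
  have "L2_set (\<lambda>n. cmod (cinner f (x n))) {..<l} \<le> K * norm f" for f l
    using assms by (intro analysis_le) auto
  then show ?thesis unfolding bessel_def
    using \<open>0 \<le> K\<close> by (auto intro: ell2_boundedI)
qed

lemma bessel_synthesis_le:
  assumes "bessel K x" and "finite S"
  shows "norm (\<Sum>n\<in>S. a n *\<^sub>C x n) \<le> K * L2_set (\<lambda>n. cmod (a n)) S"
proof (rule synthesis_le)
  show "0 \<le> K" using assms by (simp add: bessel_def)
  show "L2_set (\<lambda>n. cmod (cinner f (x n))) S \<le> K * norm f" for f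
    using assms L2_set_le_ell2_norm[OF _ assms(2)] order_trans unfolding bessel_def by blast
qed

text \<open>The truncated norms \<open>p l\<close> are continuous seminorms, bounded at each
  \<open>f\<close> by the full \<open>ell2_norm\<close>; uniform boundedness supplies one constant
  for all \<open>f\<close>.\<close>

lemma ell2_samples_imp_bessel:
  fixes x :: "nat \<Rightarrow> 'a::chilbert_space"
  assumes "\<And>f. (\<lambda>n. cinner f (x n)) \<in> ell2"
  shows "\<exists>K. bessel K x"
proof -
  define p where "p l f = L2_set (\<lambda>n. cmod (cinner f (x n))) {..<l}" for l :: nat and f
  have "\<exists>K\<ge>0. \<forall>l f. p l f \<le> K * norm f"
  proof (rule seminorms_uniformly_bounded)
    show "continuous_on UNIV (p l)" for l
      unfolding p_def L2_set_def
      by (intro continuous_intros linear_continuous_on bounded_linear_cinner_left)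
    show "p l (f + h) \<le> p l f + p l h" for l f h
    proof -
      have "p l (f + h) \<le> L2_set (\<lambda>n. cmod (cinner f (x n)) + cmod (cinner h (x n))) {..<l}"
        unfolding p_def by (rule L2_set_mono) (auto simp: cinner_add_left norm_triangle_ineq)
      also have "\<dots> \<le> p l f + p l h" unfolding p_def by (rule L2_set_triangle_ineq)
      finally show ?thesis .
    qed
    show "p l (r *\<^sub>R f) = \<bar>r\<bar> * p l f" for l r f
      unfolding p_def by (simp add: scaleR_scaleC cinner_scaleC_left norm_mult L2_set_right_distrib)
    show "\<exists>K. \<forall>l. p l f \<le> K" for f
      unfolding p_def using L2_set_le_ell2_norm[OF assms] by blast
  qed
  then obtain K where "0 \<le> K" and K: "\<And>l f. p l f \<le> K * norm f" by blast
  then have "bessel K x"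
    unfolding bessel_def p_def by (auto intro: ell2_boundedI)
  then show ?thesis by blast
qed

lemma bessel_summable:
  fixes x :: "nat \<Rightarrow> 'a::chilbert_space"
  assumes x: "bessel K x" and c: "c \<in> ell2"
  shows "summable (\<lambda>n. c n *\<^sub>C x n)"
  unfolding summable_Cauchy
proof (intro allI impI)
  fix e :: real assume "e > 0"
  have "0 \<le> K" using x by (simp add: bessel_def)
  \<comment> \<open>Dividing by \<open>K + 1\<close> covers \<open>K = 0\<close> and makes
    \<open>K * d\<close> strictly less than \<open>e\<close>.\<close>
  define d where "d = e / (K + 1)"
  have "d > 0" using \<open>e > 0\<close> \<open>0 \<le> K\<close> by (simp add: d_def)
  then obtain N where N: "\<And>m n. m \<ge> N \<Longrightarrow> norm (\<Sum>k=m..<n. (cmod (c k))\<^sup>2) < d\<^sup>2"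
    using c unfolding ell2_def mem_Collect_eq summable_Cauchy by (meson zero_less_power)
  have "norm (\<Sum>k=m..<n. c k *\<^sub>C x k) < e" if "m \<ge> N" for m n
  proof -
    have "(\<Sum>k=m..<n. (cmod (c k))\<^sup>2) \<le> d\<^sup>2" using N[OF that, of n] by simp
    then have "L2_set (\<lambda>k. cmod (c k)) {m..<n} \<le> d"
      unfolding L2_set_def using \<open>d > 0\<close> by (intro real_le_lsqrt) auto
    then have "K * L2_set (\<lambda>k. cmod (c k)) {m..<n} \<le> K * d"
      using \<open>0 \<le> K\<close> by (rule mult_left_mono)
    also have "\<dots> < e" using \<open>e > 0\<close> \<open>0 \<le> K\<close> by (simp add: d_def field_simps)
    finally show ?thesis using bessel_synthesis_le[OF x, of "{m..<n}" c] by simp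
  qed
  then show "\<exists>N. \<forall>m\<ge>N. \<forall>n. norm (\<Sum>k=m..<n. c k *\<^sub>C x k) < e" by blast
qed

text \<open>The numbers \<open>\<langle>f, R e\<^sub>n\<rangle>\<close> are the coefficients of \<open>R\<^sup>* f\<close>.\<close>

lemma dual_coefficients_ell2:
  fixes R :: "(nat \<Rightarrow> complex) \<Rightarrow> 'a::chilbert_space"
  assumes R: "bounded_clinear_on_ell2 R"
  shows "(\<lambda>n. cinner f (R (unit_seq n))) \<in> ell2"
proof -
  obtain K where "0 \<le> K" and R_bound: "\<And>x. x \<in> ell2 \<Longrightarrow> norm (R x) \<le> K * ell2_norm x"
    using ell2_operator_bounded[OF R] by blast
  \<comment> \<open>Finite combinations of the vectors \<open>R (unit_seq n)\<close> are values of
    \<open>R\<close> on truncated sequences, so a norm bound for \<open>R\<close> is a synthesis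
    bound for them.\<close>
  have "bessel K (\<lambda>n. R (unit_seq n))"
  proof (rule besselI[OF \<open>0 \<le> K\<close>])
    fix l and a :: "nat \<Rightarrow> complex"
    show "norm (\<Sum>n<l. a n *\<^sub>C R (unit_seq n)) \<le> K * L2_set (\<lambda>n. cmod (a n)) {..<l}"
      using R_bound[OF ell2_truncation(1)[of "{..<l}" a]]
      by (simp only: ell2_operator_truncation[OF R] ell2_truncation(2) finite_lessThan)
  qed
  then show ?thesis by (simp add: bessel_def)
qed

text \<open>The sum \<open>G\<close> is the value at \<open>f\<close> of the adjoint of \<open>h \<mapsto> R (\<langle>h, x\<^sub>n\<rangle>)\<^sub>n\<close>.\<close>

lemma cinner_dual_series:
  fixes R :: "(nat \<Rightarrow> complex) \<Rightarrow> 'a::chilbert_space"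
  assumes R: "bounded_clinear_on_ell2 R"
    and samples: "(\<lambda>n. cinner h (x n)) \<in> ell2"
    and sums: "(\<lambda>n. cinner f (R (unit_seq n)) *\<^sub>C x n) sums G"
  shows "cinner h G = cinner (R (\<lambda>n. cinner h (x n))) f"
proof (rule LIMSEQ_unique)
  show "(\<lambda>l. cinner h (\<Sum>n<l. cinner f (R (unit_seq n)) *\<^sub>C x n)) \<longlonglongrightarrow> cinner h G"
    using sums unfolding sums_def by (rule bounded_linear.tendsto[OF bounded_linear_cinner_right])
  have "cinner h (\<Sum>n<l. cinner f (R (unit_seq n)) *\<^sub>C x n)
      = cinner (\<Sum>n<l. cinner h (x n) *\<^sub>C R (unit_seq n)) f" for l
    unfolding cinner_sum_left cinner_sum_right cinner_scaleC_left cinner_scaleC_right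
      cinner_commute[of f, symmetric]
    by (simp add: mult.commute cinner_commute[symmetric])
  moreover have "(\<lambda>l. cinner (\<Sum>n<l. cinner h (x n) *\<^sub>C R (unit_seq n)) f)
      \<longlonglongrightarrow> cinner (R (\<lambda>n. cinner h (x n))) f"
    by (intro bounded_linear.tendsto[OF bounded_linear_cinner_left]
        ell2_operator_truncation_tendsto[OF R samples])
  ultimately show "(\<lambda>l. cinner h (\<Sum>n<l. cinner f (R (unit_seq n)) *\<^sub>C x n))
      \<longlonglongrightarrow> cinner (R (\<lambda>n. cinner h (x n))) f"
    by simp
qed

section \<open>Perturbation\<close>

text \<open>The perturbation result for arbitrary sequences, with the mixed term already absorbed.
  The bound on \<open>\<nu>\<close> lets the Bessel property pass to \<open>\<psi>\<close>, and the
  bound on \<open>\<kappa>\<close> makes the comparison operator \<open>V\<close> coercive.\<close>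

lemma frame_perturbation:
  fixes \<phi> \<psi> :: "nat \<Rightarrow> 'a::chilbert_space"
  assumes \<phi>: "\<And>f. (\<lambda>n. cinner f (\<phi> n)) \<in> ell2"
    and R: "bounded_clinear_on_ell2 R"
    and R_left_inverse: "\<And>f. R (\<lambda>n. cinner f (\<phi> n)) = f"
    and \<kappa>: "0 \<le> \<kappa>" "\<kappa> < 1" and \<nu>: "0 \<le> \<nu>" "\<nu> < 1"
    and perturbation: "\<And>l a. (norm (\<Sum>n<l. a n *\<^sub>C (\<phi> n - \<psi> n)))\<^sup>2
      \<le> \<kappa> * (norm (\<Sum>n<l. a n *\<^sub>C \<phi> n))\<^sup>2 + \<nu> * (norm (\<Sum>n<l. a n *\<^sub>C \<psi> n))\<^sup>2"
  shows "(\<forall>f. (\<lambda>n. cinner f (\<psi> n)) \<in> ell2) \<and>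
    (\<exists>R'. bounded_clinear_on_ell2 R' \<and> (\<forall>f. R' (\<lambda>n. cinner f (\<psi> n)) = f))"
proof -
  obtain K where "0 \<le> K" and R_bound: "\<And>x. x \<in> ell2 \<Longrightarrow> norm (R x) \<le> K * ell2_norm x"
    using ell2_operator_bounded[OF R] by blast
  note R_add = ell2_operator_add[OF R] and R_scale = ell2_operator_scale[OF R]

  obtain C where bessel_\<phi>: "bessel C \<phi>" using ell2_samples_imp_bessel[OF \<phi>] by blast
  then have "0 \<le> C" by (simp add: bessel_def)
  \<comment> \<open>Obtained by solving \<open>norm Q \<le> (1 + sqrt \<kappa>) * norm P + sqrt
    \<nu> * norm Q\<close> for \<open>norm Q\<close>, where \<open>P\<close> and \<open>Q\<close>
    are the finite sums over \<open>\<phi>\<close> and \<open>\<psi>\<close>.\<close>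
  define D where "D = (1 + sqrt \<kappa>) / (1 - sqrt \<nu>) * C"
  have sqrt_\<nu>: "sqrt \<nu> < 1" using \<nu> by simp
  have "0 \<le> D" using \<open>0 \<le> C\<close> sqrt_\<nu> \<kappa> by (simp add: D_def)
  have bessel_\<psi>: "bessel D \<psi>"
  proof (rule besselI[OF \<open>0 \<le> D\<close>])
    fix l and a :: "nat \<Rightarrow> complex"
    define P where "P = (\<Sum>n<l. a n *\<^sub>C \<phi> n)"
    define Q where "Q = (\<Sum>n<l. a n *\<^sub>C \<psi> n)"
    have "norm (P - Q) \<le> sqrt (\<kappa> * (norm P)\<^sup>2 + \<nu> * (norm Q)\<^sup>2)"
      using perturbation[where l = l and a = a]
      by (intro real_le_rsqrt) (simp add: P_def Q_def scaleC_diff_right sum_subtractf)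
    also have "\<dots> \<le> sqrt (\<kappa> * (norm P)\<^sup>2) + sqrt (\<nu> * (norm Q)\<^sup>2)"
      using \<kappa> \<nu> by (intro sqrt_add_le_add_sqrt) auto
    also have "\<dots> = sqrt \<kappa> * norm P + sqrt \<nu> * norm Q" by (simp add: real_sqrt_mult)
    finally have "norm (P - Q) \<le> sqrt \<kappa> * norm P + sqrt \<nu> * norm Q" .
    moreover have "norm Q \<le> norm P + norm (P - Q)"
      using norm_triangle_ineq4[of P "P - Q"] by simp
    ultimately have "(1 - sqrt \<nu>) * norm Q \<le> (1 + sqrt \<kappa>) * norm P"
      by (simp add: algebra_simps)
    then have "norm Q \<le> (1 + sqrt \<kappa>) / (1 - sqrt \<nu>) * norm P"
      using sqrt_\<nu> by (simp add: field_simps)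
    also have "\<dots> \<le> (1 + sqrt \<kappa>) / (1 - sqrt \<nu>) * (C * L2_set (\<lambda>n. cmod (a n)) {..<l})"
      unfolding P_def using sqrt_\<nu> \<kappa> bessel_\<phi>
      by (intro mult_left_mono bessel_synthesis_le) auto
    finally show "norm (\<Sum>n<l. a n *\<^sub>C \<psi> n) \<le> D * L2_set (\<lambda>n. cmod (a n)) {..<l}"
      by (simp add: Q_def D_def)
  qed
  then have \<psi>: "(\<lambda>n. cinner f (\<psi> n)) \<in> ell2"
    and \<psi>_bound: "ell2_norm (\<lambda>n. cinner f (\<psi> n)) \<le> D * norm f" for f
    by (simp_all add: bessel_def)

  \<comment> \<open>With \<open>\<phi>\<close> in place of \<open>\<psi>\<close> this would be the
    identity; \<open>V\<close> measures how far \<open>R\<close> is from recovering \<open>f\<close>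
    from the new coefficients.\<close>
  define V where "V f = R (\<lambda>n. cinner f (\<psi> n))" for f
  have V_add: "V (f + h) = V f + V h" for f h
    unfolding V_def cinner_add_left by (rule R_add) (rule \<psi>)+
  have V_scale: "V (c *\<^sub>C f) = c *\<^sub>C V f" for c f
    unfolding V_def cinner_scaleC_left by (rule R_scale) (rule \<psi>)+
  have "bounded_linear V"
  proof (rule bounded_linear_intro[where K = "K * D"])
    show "V (r *\<^sub>R f) = r *\<^sub>R V f" for r f by (simp add: scaleR_scaleC V_scale)
    show "norm (V f) \<le> norm f * (K * D)" for f
    proof -
      have "norm (V f) \<le> K * ell2_norm (\<lambda>n. cinner f (\<psi> n))" unfolding V_def by (rule R_bound[OF \<psi>])
      also have "\<dots> \<le> K * (D * norm f)" using \<open>0 \<le> K\<close> by (intro mult_left_mono \<psi>_bound)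
      finally show ?thesis by (simp add: mult_ac)
    qed
  qed (rule V_add)
  define \<alpha> where "\<alpha> = (1 - \<kappa>) / 2"
  have "\<alpha> > 0" using \<kappa> by (simp add: \<alpha>_def)
  have coercive: "\<alpha> * (norm f)\<^sup>2 \<le> inner (V f) f" for f
  proof -
    define c where "c n = cinner f (R (unit_seq n))" for n
    have c: "c \<in> ell2" unfolding c_def by (rule dual_coefficients_ell2[OF R])
    obtain F G where F: "(\<lambda>n. c n *\<^sub>C \<phi> n) sums F" and G: "(\<lambda>n. c n *\<^sub>C \<psi> n) sums G"
      using bessel_summable[OF bessel_\<phi> c] bessel_summable[OF bessel_\<psi> c] unfolding summable_def by blast
    \<comment> \<open>\<open>F\<close> is the adjoint of the identity applied to \<open>f\<close>,
      because \<open>R\<close> inverts the analysis of \<open>\<phi>\<close>. In the same way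
      \<open>G\<close> is the adjoint of \<open>V\<close> applied to \<open>f\<close>.\<close>
    have "F = f"
      by (rule cinner_eqI) (simp only: cinner_dual_series[OF R \<phi> F[unfolded c_def]] R_left_inverse)
    have "inner f G = inner (V f) f"
      unfolding inner_eq_Re_cinner V_def cinner_dual_series[OF R \<psi> G[unfolded c_def]] ..
    have "(norm (F - G))\<^sup>2 \<le> \<kappa> * (norm F)\<^sup>2 + \<nu> * (norm G)\<^sup>2"
    proof (rule LIMSEQ_le)
      show "(\<lambda>l. (norm ((\<Sum>n<l. c n *\<^sub>C \<phi> n) - (\<Sum>n<l. c n *\<^sub>C \<psi> n)))\<^sup>2) \<longlonglongrightarrow> (norm (F - G))\<^sup>2"
        using F G unfolding sums_def by (intro tendsto_intros)
      show "(\<lambda>l. \<kappa> * (norm (\<Sum>n<l. c n *\<^sub>C \<phi> n))\<^sup>2 + \<nu> * (norm (\<Sum>n<l. c n *\<^sub>C \<psi> n))\<^sup>2)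
          \<longlonglongrightarrow> \<kappa> * (norm F)\<^sup>2 + \<nu> * (norm G)\<^sup>2"
        using F G unfolding sums_def by (intro tendsto_intros)
      show "\<exists>N. \<forall>l\<ge>N. (norm ((\<Sum>n<l. c n *\<^sub>C \<phi> n) - (\<Sum>n<l. c n *\<^sub>C \<psi> n)))\<^sup>2
          \<le> \<kappa> * (norm (\<Sum>n<l. c n *\<^sub>C \<phi> n))\<^sup>2 + \<nu> * (norm (\<Sum>n<l. c n *\<^sub>C \<psi> n))\<^sup>2"
        using perturbation[where a = c] by (simp add: scaleC_diff_right sum_subtractf)
    qed
    moreover have "(norm (F - G))\<^sup>2 = (norm F)\<^sup>2 - 2 * inner F G + (norm G)\<^sup>2"
      unfolding power2_norm_eq_inner by (simp add: inner_simps inner_commute[of G F])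
    moreover have "\<nu> * (norm G)\<^sup>2 \<le> (norm G)\<^sup>2"
      using \<nu> by (simp add: mult_left_le_one_le)
    \<comment> \<open>After the square is expanded, \<open>(norm G)\<^sup>2\<close> on the left
      dominates \<open>\<nu> * (norm G)\<^sup>2\<close> on the right, and both drop out. Halving
      what is left gives the constant \<open>\<alpha>\<close>.\<close>
    ultimately have "(norm F)\<^sup>2 - \<kappa> * (norm F)\<^sup>2 \<le> 2 * inner F G" by argo
    then show ?thesis
      using \<open>inner f G = inner (V f) f\<close> unfolding \<open>F = f\<close> \<alpha>_def by (simp add: algebra_simps)
  qed
  have "bij V" and V_below: "\<And>f. \<alpha> * norm f \<le> norm (V f)"
    using coercive_bij[OF \<open>bounded_linear V\<close> \<open>\<alpha> > 0\<close> coercive] by auto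
  have V_inv: "V (inv V f) = f" and inv_V: "inv V (V f) = f" for f
    using \<open>bij V\<close> by (simp_all add: bij_is_surj surj_f_inv_f bij_is_inj)

  define R' where "R' x = inv V (R x)" for x
  have "R' (\<lambda>n. cinner f (\<psi> n)) = f" for f
    using inv_V[of f] by (simp add: R'_def V_def)
  moreover have "bounded_clinear_on_ell2 R'"
    unfolding bounded_clinear_on_ell2_def
  proof (intro conjI ballI allI exI)
    fix x y :: "nat \<Rightarrow> complex" and c :: complex assume x: "x \<in> ell2"
    show "R' (\<lambda>n. x n + y n) = R' x + R' y" if "y \<in> ell2"
      \<comment> \<open>Linearity of the inverse: \<open>V\<close> sends the sum of the two
        preimages to the sum of their images, and \<open>inv V\<close> undoes this.\<close>
      unfolding R'_def R_add[OF x that] using inv_V[of "inv V (R x) + inv V (R y)"]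
      by (simp add: V_add V_inv)
    show "R' (\<lambda>n. c * x n) = c *\<^sub>C R' x"
      unfolding R'_def R_scale[OF x] using inv_V[of "c *\<^sub>C inv V (R x)"]
      by (simp add: V_scale V_inv)
    have "\<alpha> * norm (R' x) \<le> K * ell2_norm x"
      using V_below[of "R' x"] R_bound[OF x] by (simp add: R'_def V_inv)
    then show "norm (R' x) \<le> K / \<alpha> * ell2_norm x"
      using \<open>\<alpha> > 0\<close> by (simp add: field_simps)
  qed
  ultimately show ?thesis using \<psi> by blast
qed

theorem theorem3p6:
  fixes A B :: "'a::chilbert_space \<Rightarrow> 'a"
    and g :: 'a
    and lam \<mu> \<nu> \<epsilon> :: real
  assumes "separable_space (euclidean :: 'a topology)"
    and "bounded_clinear A"
    and "bounded_clinear B"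
    and "stably_recoverable A g"
    and "lam \<ge> 0" and "\<mu> \<ge> 0" and "\<nu> \<ge> 0"
    and "\<And>(l::nat) (a :: nat \<Rightarrow> complex).
      (norm (\<Sum>n=0..l. a n *\<^sub>C ((cadjoint A ^^ n) g - (cadjoint B ^^ n) g)))\<^sup>2
        \<le> lam * (norm (\<Sum>n=0..l. a n *\<^sub>C (cadjoint A ^^ n) g))\<^sup>2
          + \<mu> * norm (\<Sum>n=0..l. a n *\<^sub>C (cadjoint A ^^ n) g)
              * norm (\<Sum>n=0..l. a n *\<^sub>C (cadjoint B ^^ n) g)
          + \<nu> * (norm (\<Sum>n=0..l. a n *\<^sub>C (cadjoint B ^^ n) g))\<^sup>2"
    and "\<epsilon> > 0"
    and "2 * (1 - \<nu>) * \<epsilon>\<^sup>2 - (\<mu> + 2 * \<nu>) * \<epsilon> - \<mu> > 0"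
    and "max (lam + \<mu> * \<epsilon> / 2) (\<mu> / (2 * \<epsilon>) + \<nu>) < 1"
  shows "stably_recoverable B g"
proof -
  define \<phi> where "\<phi> n = (cadjoint A ^^ n) g" for n
  define \<psi> where "\<psi> n = (cadjoint B ^^ n) g" for n
  have samples_A: "samples A g f = (\<lambda>n. cinner f (\<phi> n))" for f
    unfolding \<phi>_def using samples_eq_cinner_cadjoint[OF assms(2)] by blast
  have samples_B: "samples B g f = (\<lambda>n. cinner f (\<psi> n))" for f
    unfolding \<psi>_def using samples_eq_cinner_cadjoint[OF assms(3)] by blast
  obtain R where \<phi>: "\<And>f. (\<lambda>n. cinner f (\<phi> n)) \<in> ell2"
    and R: "bounded_clinear_on_ell2 R" "\<And>f. R (\<lambda>n. cinner f (\<phi> n)) = f"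
    using assms(4) unfolding stably_recoverable_def samples_A by blast
  \<comment> \<open>The two sides differ by a nonnegative multiple of the square of
    \<open>\<epsilon> * p - q\<close>. The resulting coefficients are exactly those in the maximum
    condition.\<close>
  have young: "\<mu> * p * q \<le> \<mu> * \<epsilon> / 2 * p\<^sup>2 + \<mu> / (2 * \<epsilon>) * q\<^sup>2" for p q :: real
  proof -
    have "\<mu> * \<epsilon> / 2 * p\<^sup>2 + \<mu> / (2 * \<epsilon>) * q\<^sup>2 - \<mu> * p * q = \<mu> / (2 * \<epsilon>) * (\<epsilon> * p - q)\<^sup>2"
      using \<open>\<epsilon> > 0\<close> by (simp add: field_simps power2_eq_square)
    also have "\<dots> \<ge> 0" using \<open>\<epsilon> > 0\<close> \<open>\<mu> \<ge> 0\<close> by simp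
    finally show ?thesis by simp
  qed
  have "(\<forall>f. (\<lambda>n. cinner f (\<psi> n)) \<in> ell2) \<and>
    (\<exists>R'. bounded_clinear_on_ell2 R' \<and> (\<forall>f. R' (\<lambda>n. cinner f (\<psi> n)) = f))"
  proof (rule frame_perturbation[OF \<phi> R])
    show "0 \<le> lam + \<mu> * \<epsilon> / 2" "0 \<le> \<mu> / (2 * \<epsilon>) + \<nu>"
      using assms(5-7,9) by simp_all
    show "lam + \<mu> * \<epsilon> / 2 < 1" "\<mu> / (2 * \<epsilon>) + \<nu> < 1" using assms(11) by simp_all
    fix l and a :: "nat \<Rightarrow> complex"
    let ?P = "norm (\<Sum>n<l. a n *\<^sub>C \<phi> n)" and ?Q = "norm (\<Sum>n<l. a n *\<^sub>C \<psi> n)"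
    show "(norm (\<Sum>n<l. a n *\<^sub>C (\<phi> n - \<psi> n)))\<^sup>2
      \<le> (lam + \<mu> * \<epsilon> / 2) * ?P\<^sup>2 + (\<mu> / (2 * \<epsilon>) + \<nu>) * ?Q\<^sup>2"
    \<comment> \<open>The hypothesis sums over \<open>{0..m}\<close>, which is never empty, whereas
      the lemma sums over \<open>{..<l}\<close>. For \<open>l = 0\<close> all sums vanish; otherwise
      \<open>m\<close> is the predecessor of \<open>l\<close>.\<close>
    proof (cases l)
      case (Suc m)
      have "{0..m} = {..<l}" using Suc by auto
      then have "(norm (\<Sum>n<l. a n *\<^sub>C (\<phi> n - \<psi> n)))\<^sup>2 \<le> lam * ?P\<^sup>2 + \<mu> * ?P * ?Q + \<nu> * ?Q\<^sup>2"
        using assms(8)[of a m] by (simp add: \<phi>_def \<psi>_def)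
      then show ?thesis using young[of ?P ?Q] by (simp add: algebra_simps)
    qed simp
  qed
  then show ?thesis unfolding stably_recoverable_def samples_B .
qed

end
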